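(* Let $\mathcal A$ be a finite alphabet. For every closed RLL expression $e$ over $\mathcal A$, the language denoted by $e$ equals the language accepted by the alternating parity automaton $\mathbf A_e$ (for any choice of colouring $c_e$ allowed in its definition): $\mathcal L(e)=\mathcal L(\mathbf A_e)$.
   Context: Fix a finite alphabet $\mathcal A$ and a countable set of variables. RLL expressions are generated by $$e,f ::= X \mid a\cdot e \mid e+f \mid e\cap f \mid \mu X\, e \mid \nu X\, e\qquad (a\in\mathcal A),$$ with $\mu X,\nu X$ binding $X$; $a\cdot e$ is written $ae$. An expression is closed if it has no free variables. Abbreviations: $0:=\mu X\,X$, $\top:=\nu X\,X$. Language interpretation: expand the syntax by a constant for each $A\subseteq\mathcal A^\omega$. For closed expressions: $\mathcal L(A)=A$; $\mathcal L(e+f)=\mathcal L(e)\cup\mathcal L(f)$; $\mathcal L(e\cap f)=\mathcal L(e)\cap\mathcal L(f)$; $\mathcal L(ae)=\{a\sigma:\sigma\in\mathcal L(e)\}$; $\mathcal L(\mu X e(X))=\bigcap\{A\subseteq\mathcal A^\omega: A\supseteq\mathcal L(e(A))\}$; $\mathcal L(\nu X e(X))=\bigcup\{A\subseteq\mathcal A^\omega: A\subseteq\mathcal L(e(A))\}$. Fischer–Ladner closure: $\to_{\mathrm{FL}}$ is the smallest relation on expressions with $ae\to_{\mathrm{FL}}e$; $e_0\star e_1\to_{\mathrm{FL}}e_i$ for $i\in\{0,1\}$, $\star\in\{+,\cap\}$; $\sigma X e(X)\to_{\mathrm{FL}}e(\sigma X e(X))$ for $\sigma\in\{\mu,\nu\}$.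 $\mathrm{FL}(e)$ is the (finite) set of expressions reachable from $e$ by the reflexive transitive closure of $\to_{\mathrm{FL}}$. Write $f\sqsubseteq g$ if $f$ is a subformula of $g$. The alternating parity automaton $\mathbf A_e$ (with $\varepsilon$-transitions): states $\mathrm{FL}(e)$, initial state $e$; states of the form $0$ or $f+g$ are existential, states of the form $\top$ or $f\cap g$ are universal (from any other state there is at most one available transition). Transitions: $af\xrightarrow{a}f$ for each $af\in\mathrm{FL}(e)$ (reading the letter $a$), and an $\varepsilon$-transition $g\to g'$ whenever $g\to_{\mathrm{FL}}g'$ and $g$ is not of the form $af$. Colouring: any function $c_e:\mathrm{FL}(e)\to\mathbb N$ such that $f\sqsubseteq g\Rightarrow c_e(f)\le c_e(g)$, $c_e(\mu X f)$ is always odd, and $c_e(\nu X f)$ is always even. Acceptance is the usual one, by the acceptance game on pairs (remaining word, state) starting from $(w,e)$: the existential player chooses the transition at existential states, the universal player at universal states; a play reaching a state $bf$ when the next letter of the word is not $b$ is stuck and lost by the existential player; an infinite play is won by the existential player iff the minimum colour occurring infinitely often is even. $\mathcal L(\mathbf A_e)$ is the set of $w\in\mathcal A^\omega$ for which the existential player has a winning strategy. *)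

theory Defs
  imports Main "HOL-Library.Stream" "HOL-Library.Infinite_Set"
begin

section \<open>Expressions\<close>

text \<open>
  The syntax is expanded by a constant \<open>Lang A\<close> for every set \<open>A\<close> of \<open>\<omega>\<close>-words; the RLL
  expressions proper are those without such constants. Bound variables are named, and expressions
  are not identified up to renaming.
\<close>

type_synonym var = nat

datatype 'a expr =
    Var var
  | Lang "'a stream set"
  | Act 'a "'a expr"
  | Sum "'a expr" "'a expr"
  | Cap "'a expr" "'a expr"
  | Mu var "'a expr"
  | Nu var "'a expr"

primrec rll :: "'a expr \<Rightarrow> bool" where
  "rll (Var X) = True"
| "rll (Lang A) = False"
| "rll (Act a e) = rll e"
| "rll (Sum e f) = (rll e \<and> rll f)"
| "rll (Cap e f) = (rll e \<and> rll f)"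
| "rll (Mu X e) = rll e"
| "rll (Nu X e) = rll e"

primrec free_vars :: "'a expr \<Rightarrow> var set" where
  "free_vars (Var X) = {X}"
| "free_vars (Lang A) = {}"
| "free_vars (Act a e) = free_vars e"
| "free_vars (Sum e f) = free_vars e \<union> free_vars f"
| "free_vars (Cap e f) = free_vars e \<union> free_vars f"
| "free_vars (Mu X e) = free_vars e - {X}"
| "free_vars (Nu X e) = free_vars e - {X}"

definition closed_expr :: "'a expr \<Rightarrow> bool" where
  "closed_expr e \<longleftrightarrow> free_vars e = {}"

text \<open>
  \<open>subst X g e\<close> replaces the free occurrences of \<open>X\<close> in \<open>e\<close> by \<open>g\<close>. Nothing is renamed, so this is
  the usual substitution only if no variable of \<open>g\<close> is captured; below, \<open>g\<close> is always closed.
\<close>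

primrec subst :: "var \<Rightarrow> 'a expr \<Rightarrow> 'a expr \<Rightarrow> 'a expr" where
  "subst X g (Var Y) = (if Y = X then g else Var Y)"
| "subst X g (Lang A) = Lang A"
| "subst X g (Act a e) = Act a (subst X g e)"
| "subst X g (Sum e f) = Sum (subst X g e) (subst X g f)"
| "subst X g (Cap e f) = Cap (subst X g e) (subst X g f)"
| "subst X g (Mu Y e) = Mu Y (if Y = X then e else subst X g e)"
| "subst X g (Nu Y e) = Nu Y (if Y = X then e else subst X g e)"

primrec subformulas :: "'a expr \<Rightarrow> 'a expr set" where
  "subformulas (Var X) = {Var X}"
| "subformulas (Lang A) = {Lang A}"
| "subformulas (Act a e) = insert (Act a e) (subformulas e)"
| "subformulas (Sum e f) = insert (Sum e f) (subformulas e \<union> subformulas f)"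
| "subformulas (Cap e f) = insert (Cap e f) (subformulas e \<union> subformulas f)"
| "subformulas (Mu X e) = insert (Mu X e) (subformulas e)"
| "subformulas (Nu X e) = insert (Nu X e) (subformulas e)"


section \<open>Language semantics\<close>

primrec height :: "'a expr \<Rightarrow> nat" where
  "height (Var X) = 0"
| "height (Lang A) = 0"
| "height (Act a e) = Suc (height e)"
| "height (Sum e f) = Suc (max (height e) (height f))"
| "height (Cap e f) = Suc (max (height e) (height f))"
| "height (Mu X e) = Suc (height e)"
| "height (Nu X e) = Suc (height e)"

lemma height_subst_Lang [simp]: "height (subst X (Lang A) e) = height e"
  by (induction e) auto

text \<open>Only the values on closed expressions are meaningful; the one at a variable is a dummy.\<close>

function lang :: "'a expr \<Rightarrow> 'a stream set" where
  "lang (Var X) = {}"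
| "lang (Lang A) = A"
| "lang (Act a e) = {a ## w | w. w \<in> lang e}"
| "lang (Sum e f) = lang e \<union> lang f"
| "lang (Cap e f) = lang e \<inter> lang f"
| "lang (Mu X e) = \<Inter> {A. A \<supseteq> lang (subst X (Lang A) e)}"
| "lang (Nu X e) = \<Union> {A. A \<subseteq> lang (subst X (Lang A) e)}"
  by pat_completeness auto
termination by (relation "measure height") auto


section \<open>Fischer--Ladner closure\<close>

inductive fl_step :: "'a expr \<Rightarrow> 'a expr \<Rightarrow> bool" where
  "fl_step (Act a e) e"
| "fl_step (Sum e f) e"
| "fl_step (Sum e f) f"
| "fl_step (Cap e f) e"
| "fl_step (Cap e f) f"
| "fl_step (Mu X e) (subst X (Mu X e) e)"
| "fl_step (Nu X e) (subst X (Nu X e) e)"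

definition FL :: "'a expr \<Rightarrow> 'a expr set" where
  "FL e = {f. fl_step\<^sup>*\<^sup>* e f}"


section \<open>Alternating parity automata\<close>

text \<open>
  \<open>trans A q (Some a) q'\<close> is a transition reading \<open>a\<close>, and \<open>trans A q None q'\<close> is an
  \<open>\<epsilon>\<close>-transition. From a state that is neither existential nor universal at most one transition
  is supposed to be available, so that no player has a choice there.
\<close>

record ('a, 's) apa =
  states :: "'s set"
  initial :: 's
  existential :: "'s set"
  universal :: "'s set"
  trans :: "'s \<Rightarrow> 'a option \<Rightarrow> 's \<Rightarrow> bool"
  colour :: "'s \<Rightarrow> nat"

type_synonym ('a, 's) position = "'a stream \<times> 's"

inductive move :: "('a, 's) apa \<Rightarrow> ('a, 's) position \<Rightarrow> ('a, 's) position \<Rightarrow> bool"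
  for A :: "('a, 's) apa" where
  "trans A q (Some a) q' \<Longrightarrow> move A (a ## w, q) (w, q')"
| "trans A q None q' \<Longrightarrow> move A (w, q) (w, q')"

definition stuck :: "('a, 's) apa \<Rightarrow> ('a, 's) position \<Rightarrow> bool" where
  "stuck A p \<longleftrightarrow> (\<nexists>p'. move A p p')"

text \<open>
  A strategy of the existential player maps the history of a play, including the current position,
  to the next position.
\<close>

type_synonym ('a, 's) strategy = "('a, 's) position list \<Rightarrow> ('a, 's) position"

inductive conforming ::
    "('a, 's) apa \<Rightarrow> ('a, 's) strategy \<Rightarrow> ('a, 's) position \<Rightarrow> ('a, 's) position list \<Rightarrow> bool"
  for A :: "('a, 's) apa" and S :: "('a, 's) strategy" and p :: "('a, 's) position" where
  "conforming A S p [p]"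
| "conforming A S p \<rho> \<Longrightarrow> move A (last \<rho>) p' \<Longrightarrow>
    (snd (last \<rho>) \<in> existential A \<Longrightarrow> p' = S \<rho>) \<Longrightarrow> conforming A S p (\<rho> @ [p'])"

definition parity_win :: "(nat \<Rightarrow> nat) \<Rightarrow> bool" where
  "parity_win c \<longleftrightarrow>
    (\<exists>k. (\<exists>\<^sub>\<infinity>n. c n = k) \<and> (\<forall>j. (\<exists>\<^sub>\<infinity>n. c n = j) \<longrightarrow> k \<le> j) \<and> even k)"

text \<open>
  The conditions are, in order: the strategy proposes a legal move whenever the existential player
  has one to make; plays getting stuck outside the universal states are lost by the existential
  player; infinite plays are decided by the parity condition.
\<close>

definition winning_strategy ::
    "('a, 's) apa \<Rightarrow> ('a, 's) strategy \<Rightarrow> ('a, 's) position \<Rightarrow> bool" where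
  "winning_strategy A S p \<longleftrightarrow>
    (\<forall>\<rho>. conforming A S p \<rho> \<and> snd (last \<rho>) \<in> existential A \<and> \<not> stuck A (last \<rho>) \<longrightarrow>
         move A (last \<rho>) (S \<rho>)) \<and>
    (\<forall>\<rho>. conforming A S p \<rho> \<and> stuck A (last \<rho>) \<longrightarrow> snd (last \<rho>) \<in> universal A) \<and>
    (\<forall>\<pi>. (\<forall>n. conforming A S p (map \<pi> [0..<Suc n])) \<longrightarrow>
         parity_win (\<lambda>n. colour A (snd (\<pi> n))))"

definition accepted :: "('a, 's) apa \<Rightarrow> 'a stream set" where
  "accepted A = {w. \<exists>S. winning_strategy A S (w, initial A)}"


section \<open>The automaton of an expression\<close>

definition is_colouring :: "'a expr \<Rightarrow> ('a expr \<Rightarrow> nat) \<Rightarrow> bool" where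
  "is_colouring e c \<longleftrightarrow>
    (\<forall>f \<in> FL e. \<forall>g \<in> FL e. f \<in> subformulas g \<longrightarrow> c f \<le> c g) \<and>
    (\<forall>X f. Mu X f \<in> FL e \<longrightarrow> odd (c (Mu X f))) \<and>
    (\<forall>X f. Nu X f \<in> FL e \<longrightarrow> even (c (Nu X f)))"

inductive expr_trans :: "'a expr \<Rightarrow> 'a option \<Rightarrow> 'a expr \<Rightarrow> bool" where
  "expr_trans (Act a f) (Some a) f"
| "fl_step g g' \<Longrightarrow> \<nexists>a f. g = Act a f \<Longrightarrow> expr_trans g None g'"

text \<open>Here \<open>Mu X (Var X)\<close> is the expression \<open>0\<close> and \<open>Nu X (Var X)\<close> is \<open>\<top>\<close>.\<close>

definition expr_apa :: "'a expr \<Rightarrow> ('a expr \<Rightarrow> nat) \<Rightarrow> ('a, 'a expr) apa" where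
  "expr_apa e c =
    \<lparr> states = FL e,
      initial = e,
      existential = {q \<in> FL e. (\<exists>X. q = Mu X (Var X)) \<or> (\<exists>f g. q = Sum f g)},
      universal = {q \<in> FL e. (\<exists>X. q = Nu X (Var X)) \<or> (\<exists>f g. q = Cap f g)},
      trans = (\<lambda>q l q'. q \<in> FL e \<and> q' \<in> FL e \<and> expr_trans q l q'),
      colour = c \<rparr>"

end

theory Submission
  imports Defs
begin

text \<open>
  Fix one of the players, the existential one (\<open>b = True\<close>) or the universal one (\<open>b = False\<close>), and
  annotate the fixed points that are bad for this player (\<open>\<mu>\<close>, respectively \<open>\<nu>\<close>) by words: under
  the annotation \<open>v\<close> such a fixed point denotes (respectively excludes) only the words of smaller
  rank than \<open>v\<close> in the inductive generation of the least fixed point (respectively of the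
  complement of the greatest one). If the player's claim
  ``\<open>w \<in> lang f\<close>'' (respectively ``\<open>w \<notin> lang f\<close>'') holds at a position, the player can keep it true
  along a play, annotating every formula by the remaining word when it is visited and dropping the
  annotations of its proper superformulas. On an infinite play the infinitely recurring formula of
  least height is a fixed point and a subformula of all later formulas, so its annotation is never
  dropped; were it bad for the player, the ranks would decrease forever. Hence the player wins the
  play. For the existential player this gives a winning strategy from each word in \<open>lang e\<close>; for
  the universal player it gives a play refuting any strategy from a word outside \<open>lang e\<close>.
\<close>

section \<open>Ranks in least fixed points\<close>

text \<open>Stages of the iteration of \<open>F\<close> from below, without ordinals: the empty
  union supplies the start \<open>{}\<close>, other unions the limits.\<close>

inductive_set approximants :: "('b set \<Rightarrow> 'b set) \<Rightarrow> 'b set set" for F where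
  step: "A \<in> approximants F \<Longrightarrow> F A \<in> approximants F"
| Union: "(\<And>A. A \<in> M \<Longrightarrow> A \<in> approximants F) \<Longrightarrow> \<Union>M \<in> approximants F"

text \<open>
  The approximants are well-ordered by inclusion; \<open>below F w\<close> is the last one without \<open>w\<close>, that is,
  the set of points of smaller rank than \<open>w\<close>.
\<close>

definition below :: "('b set \<Rightarrow> 'b set) \<Rightarrow> 'b \<Rightarrow> 'b set" where
  "below F w = \<Union>{A \<in> approximants F. w \<notin> A}"

lemma below_approximant: "below F w \<in> approximants F"
  unfolding below_def by (rule approximants.Union) auto

lemma not_in_below: "w \<notin> below F w"
  by (simp add: below_def)

lemma approximant_le_below: "w \<notin> A \<Longrightarrow> A \<in> approximants F \<Longrightarrow> A \<subseteq> below F w"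
  by (auto simp: below_def)

lemma approximants_inflationary:
  assumes "mono F" "A \<in> approximants F"
  shows "A \<subseteq> F A"
  using assms(2)
proof induction
  case (step A)
  then show ?case using assms(1) by (simp add: monoD)
next
  case (Union M)
  have "A \<subseteq> F (\<Union>M)" if "A \<in> M" for A
    using Union.IH[OF that] monoD[OF assms(1), of A "\<Union>M"] that by blast
  then show ?case by blast
qed

lemma approximants_le_lfp:
  assumes "mono F" "A \<in> approximants F"
  shows "A \<subseteq> lfp F"
  using assms(2)
proof induction
  case (step A)
  then show ?case using monoD[OF assms(1)] lfp_unfold[OF assms(1)] by blast
next
  case (Union M)
  then show ?case by blast
qed

text \<open>Zermelo's chain argument: the dichotomy is first shown for an \<open>A\<close> that
  contains \<open>F B\<close> for every smaller stage \<open>B\<close>; then every stage turns out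
  to be such an \<open>A\<close>.\<close>

lemma approximants_no_gap:
  assumes "mono F" "A \<in> approximants F" "B \<in> approximants F"
  shows "B \<subseteq> A \<or> F A \<subseteq> B"
proof -
  have extreme: "B \<subseteq> A \<or> F A \<subseteq> B"
    if ext: "\<And>B. B \<in> approximants F \<Longrightarrow> B \<subset> A \<Longrightarrow> F B \<subseteq> A"
      and "B \<in> approximants F" for A B
    using that(2)
  proof induction
    case (step B)
    then show ?case
      using ext[of B] approximants_inflationary[OF assms(1) step.hyps] by blast
  next
    case (Union M)
    then show ?case by blast
  qed
  have "F B \<subseteq> A" if "A \<in> approximants F" "B \<in> approximants F" "B \<subset> A" for A B
    using that
  proof (induction arbitrary: B)
    case (step A)
    then have "B \<subseteq> A" using extreme[of A B] by blast
    then show ?case using assms(1) by (simp add: monoD)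
  next
    case (Union M)
    then obtain A where A: "A \<in> M" "\<not> A \<subseteq> B" by blast
    have "B \<subseteq> A \<or> F A \<subseteq> B"
      by (rule extreme) (use A Union in blast)+
    moreover have "A \<subseteq> F A"
      using approximants_inflationary[OF assms(1)] A Union by blast
    ultimately have "B \<subset> A" using A by blast
    then show ?case using Union A by blast
  qed
  then show ?thesis by (intro extreme[OF _ assms(3)]) (use assms(2) in simp)
qed

text \<open>Otherwise \<open>F (below F w)\<close> would be another approximant without
  \<open>w\<close>, hence included in \<open>below F w\<close>; the latter would then contain
  \<open>lfp F\<close> and so \<open>w\<close>.\<close>

lemma lfp_below:
  assumes "mono F" "w \<in> lfp F"
  shows "w \<in> F (below F w)"
proof (rule ccontr)
  assume "w \<notin> F (below F w)"
  moreover have "F (below F w) \<in> approximants F"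
    by (rule approximants.step[OF below_approximant])
  ultimately have "F (below F w) \<subseteq> below F w"
    by (intro approximant_le_below)
  then have "lfp F \<subseteq> below F w" by (rule lfp_lowerbound)
  then show False using assms(2) not_in_below[of w F] by (simp add: subset_iff)
qed

lemma below_le_lfp: "mono F \<Longrightarrow> below F w \<subseteq> lfp F"
  by (rule approximants_le_lfp[OF _ below_approximant])

text \<open>Well-foundedness of the rank: if every point of \<open>Q\<close> had a point of smaller
  rank in \<open>Q\<close>, no approximant could be the first to meet \<open>Q\<close>.\<close>

lemma below_minimal:
  assumes "mono F" "Q \<noteq> {}"
  shows "\<exists>w\<in>Q. below F w \<inter> Q = {}"
proof (rule ccontr)
  assume *: "\<not> ?thesis"
  have "A \<inter> Q = {}" if "A \<in> approximants F" for A
    using that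
  proof induction
    case (step A)
    show ?case
    proof (rule ccontr)
      assume "F A \<inter> Q \<noteq> {}"
      then obtain w where w: "w \<in> F A" "w \<in> Q" by blast
      \<comment> \<open>\<open>B\<close> is a stage that contains \<open>u\<close> but not yet
        \<open>w\<close>; with no gap after \<open>A\<close> it lies inside \<open>A\<close>, which
        misses \<open>Q\<close>.\<close>
      then obtain u B where "u \<in> Q" "u \<in> B" "B \<in> approximants F" "w \<notin> B"
        using * unfolding below_def by blast
      then show False
        using approximants_no_gap[OF assms(1) step.hyps] step.IH w by blast
    qed
  qed blast
  moreover obtain w where "w \<in> Q" using assms(2) by blast
  ultimately show False using * below_approximant[of F w] by blast
qed

section \<open>Ranks of points outside a greatest fixed point\<close>

definition dual :: "('b set \<Rightarrow> 'b set) \<Rightarrow> 'b set \<Rightarrow> 'b set" where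
  "dual F A = - F (- A)"

lemma mono_dual: "mono F \<Longrightarrow> mono (dual F)"
  by (auto simp: mono_def dual_def)

text \<open>The sets closed under \<open>dual F\<close> are the complements of those with
  \<open>A \<subseteq> F A\<close>. Words outside \<open>gfp F\<close> thus get ranks from
  \<open>dual F\<close>.\<close>

lemma gfp_eq_dual_lfp: "gfp F = - lfp (dual F)" for F :: "'b set \<Rightarrow> 'b set"
proof -
  have "\<Union>{A. A \<subseteq> F A} = - \<Inter>{A. dual F A \<subseteq> A}"
  proof (intro equalityI subsetI)
    fix x assume "x \<in> \<Union>{A. A \<subseteq> F A}"
    then obtain A where "A \<subseteq> F A" "x \<in> A" by blast
    then have "dual F (- A) \<subseteq> - A" "x \<notin> - A" by (auto simp: dual_def)
    then show "x \<in> - \<Inter>{A. dual F A \<subseteq> A}" by blast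
  next
    fix x assume "x \<in> - \<Inter>{A. dual F A \<subseteq> A}"
    then obtain A where "dual F A \<subseteq> A" "x \<notin> A" by blast
    then have "- A \<subseteq> F (- A)" "x \<in> - A" by (auto simp: dual_def)
    then show "x \<in> \<Union>{A. A \<subseteq> F A}" by blast
  qed
  then show ?thesis by (simp add: gfp_def lfp_def)
qed

section \<open>Subformulas and traces\<close>

lemma subformulas_refl [simp]: "f \<in> subformulas f"
  by (cases f) auto

lemma subformulas_trans: "f \<in> subformulas g \<Longrightarrow> g \<in> subformulas h \<Longrightarrow> f \<in> subformulas h"
  by (induction h) auto

lemma height_subformula: "f \<in> subformulas g \<Longrightarrow> f = g \<or> height f < height g"
  by (induction g) auto

lemma subst_fresh: "X \<notin> free_vars f \<Longrightarrow> subst X g f = f"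
  by (induction f) auto

lemma subformula_subst_free: "X \<in> free_vars f \<Longrightarrow> g \<in> subformulas (subst X g f)"
  by (induction f) auto

lemma free_vars_subst_closed:
  "free_vars g = {} \<Longrightarrow> free_vars (subst X g f) = free_vars f - {X}"
  by (induction f) auto

text \<open>A subformula of the instance lies inside a copy of \<open>g\<close> or stems from a
  subformula of \<open>f\<close>; if the substitution changed the latter, it placed a copy of
  \<open>g\<close> in it.\<close>

lemma subformula_substD:
  "m \<in> subformulas (subst X g f) \<Longrightarrow>
    m \<in> subformulas f \<or> m \<in> subformulas g \<or> g \<in> subformulas m"
proof (induction f)
  case (Act a f)
  show ?case
  proof (cases "X \<in> free_vars (Act a f)")
    case True
    then have "g \<in> subformulas (subst X g (Act a f))" by (rule subformula_subst_free)
    then show ?thesis using Act by (auto split: if_splits)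
  next
    case False
    then show ?thesis using Act.prems by (simp add: subst_fresh del: subst.simps subformulas.simps)
  qed
next
  case (Sum f1 f2)
  show ?case
  proof (cases "X \<in> free_vars (Sum f1 f2)")
    case True
    then have "g \<in> subformulas (subst X g (Sum f1 f2))" by (rule subformula_subst_free)
    then show ?thesis using Sum by (auto split: if_splits)
  next
    case False
    then show ?thesis using Sum.prems by (simp add: subst_fresh del: subst.simps subformulas.simps)
  qed
next
  case (Cap f1 f2)
  show ?case
  proof (cases "X \<in> free_vars (Cap f1 f2)")
    case True
    then have "g \<in> subformulas (subst X g (Cap f1 f2))" by (rule subformula_subst_free)
    then show ?thesis using Cap by (auto split: if_splits)
  next
    case False
    then show ?thesis using Cap.prems by (simp add: subst_fresh del: subst.simps subformulas.simps)
  qed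
next
  case (Mu Y f)
  show ?case
  proof (cases "X \<in> free_vars (Mu Y f)")
    case True
    then have "g \<in> subformulas (subst X g (Mu Y f))" by (rule subformula_subst_free)
    then show ?thesis using Mu by (auto split: if_splits)
  next
    case False
    then show ?thesis using Mu.prems by (simp add: subst_fresh del: subst.simps subformulas.simps)
  qed
next
  case (Nu Y f)
  show ?case
  proof (cases "X \<in> free_vars (Nu Y f)")
    case True
    then have "g \<in> subformulas (subst X g (Nu Y f))" by (rule subformula_subst_free)
    then show ?thesis using Nu by (auto split: if_splits)
  next
    case False
    then show ?thesis using Nu.prems by (simp add: subst_fresh del: subst.simps subformulas.simps)
  qed
qed (auto split: if_splits)

lemma fl_step_closed: "fl_step f g \<Longrightarrow> closed_expr f \<Longrightarrow> closed_expr g"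
  unfolding closed_expr_def by (induction rule: fl_step.induct) (auto simp: free_vars_subst_closed)

lemma rll_subst: "rll f \<Longrightarrow> rll g \<Longrightarrow> rll (subst X g f)"
  by (induction f) auto

lemma fl_step_rll: "fl_step f g \<Longrightarrow> rll f \<Longrightarrow> rll g"
  by (induction rule: fl_step.induct) (auto simp: rll_subst)

lemma FL_refl: "e \<in> FL e"
  by (simp add: FL_def)

lemma FL_step: "f \<in> FL e \<Longrightarrow> fl_step f g \<Longrightarrow> g \<in> FL e"
  by (simp add: FL_def)

lemma FL_closed:
  assumes "closed_expr e" "f \<in> FL e"
  shows "closed_expr f"
proof -
  have "fl_step\<^sup>*\<^sup>* e f" using assms(2) by (simp add: FL_def)
  then show ?thesis using assms(1) by induction (auto intro: fl_step_closed)
qed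

lemma FL_rll:
  assumes "rll e" "f \<in> FL e"
  shows "rll f"
proof -
  have "fl_step\<^sup>*\<^sup>* e f" using assms(2) by (simp add: FL_def)
  then show ?thesis using assms(1) by induction (auto intro: fl_step_rll)
qed

section \<open>Finiteness of the Fischer-Ladner closure\<close>

primrec msubst :: "(var \<Rightarrow> 'a expr) \<Rightarrow> 'a expr \<Rightarrow> 'a expr" where
  "msubst \<theta> (Var X) = \<theta> X"
| "msubst \<theta> (Lang A) = Lang A"
| "msubst \<theta> (Act a e) = Act a (msubst \<theta> e)"
| "msubst \<theta> (Sum e f) = Sum (msubst \<theta> e) (msubst \<theta> f)"
| "msubst \<theta> (Cap e f) = Cap (msubst \<theta> e) (msubst \<theta> f)"
| "msubst \<theta> (Mu X e) = Mu X (msubst (\<theta>(X := Var X)) e)"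
| "msubst \<theta> (Nu X e) = Nu X (msubst (\<theta>(X := Var X)) e)"

lemma msubst_Var [simp]: "msubst Var e = e"
  by (induction e) auto

text \<open>Unfolding an instance of a fixed point thus only extends the environment, which permits
  structural induction on open expressions. The assumption keeps \<open>X\<close> from being free in
  the values of other variables.\<close>

lemma subst_msubst:
  assumes "\<And>Y. closed_expr (\<theta> Y) \<or> \<theta> Y = Var Y"
  shows "subst X m (msubst (\<theta>(X := Var X)) e) = msubst (\<theta>(X := m)) e"
  using assms
proof (induction e arbitrary: \<theta>)
  case (Var Y)
  have "subst X m (\<theta> Y) = \<theta> Y" if "Y \<noteq> X"
    using Var[of Y] that subst_fresh[of X "\<theta> Y" m] by (auto simp: closed_expr_def)
  then show ?case by auto
next
  case (Mu Y e)
  have "subst X m (msubst (\<theta>(Y := Var Y, X := Var X)) e) = msubst (\<theta>(Y := Var Y, X := m)) e"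
    by (rule Mu.IH) (use Mu.prems in auto)
  then show ?case by (cases "Y = X") (simp_all add: fun_upd_twist del: fun_upd_apply)
next
  case (Nu Y e)
  have "subst X m (msubst (\<theta>(Y := Var Y, X := Var X)) e) = msubst (\<theta>(Y := Var Y, X := m)) e"
    by (rule Nu.IH) (use Nu.prems in auto)
  then show ?case by (cases "Y = X") (simp_all add: fun_upd_twist del: fun_upd_apply)
qed auto

lemma free_vars_msubst:
  assumes "\<And>Y. Y \<in> free_vars e - B \<Longrightarrow> closed_expr (\<theta> Y)" "\<And>Y. Y \<in> B \<Longrightarrow> \<theta> Y = Var Y"
  shows "free_vars (msubst \<theta> e) \<subseteq> B"
  using assms
proof (induction e arbitrary: \<theta> B)
  case (Mu X e)
  have "free_vars (msubst (\<theta>(X := Var X)) e) \<subseteq> insert X B"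
    by (rule Mu.IH) (use Mu.prems in auto)
  then show ?case by auto
next
  case (Nu X e)
  have "free_vars (msubst (\<theta>(X := Var X)) e) \<subseteq> insert X B"
    by (rule Nu.IH) (use Nu.prems in auto)
  then show ?case by auto
next
  case (Var X)
  then show ?case by (cases "X \<in> B") (auto simp: closed_expr_def)
next
  case (Sum e f)
  from Sum.prems Sum.IH(1)[of B \<theta>] Sum.IH(2)[of B \<theta>] show ?case by auto
next
  case (Cap e f)
  from Cap.prems Cap.IH(1)[of B \<theta>] Cap.IH(2)[of B \<theta>] show ?case by auto
qed auto

inductive_cases fl_stepE:
  "fl_step (Var X) g" "fl_step (Lang A) g" "fl_step (Act a f) g" "fl_step (Sum f f') g"
  "fl_step (Cap f f') g" "fl_step (Mu X f) g" "fl_step (Nu X f) g"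

text \<open>\<open>T\<close> is closed under steps up to exits to the values of free variables; a
  closed \<open>e\<close> has no exits. At a fixed point \<open>m\<close>, the body is taken with
  \<open>X\<close> mapped to \<open>m\<close>, so exits through \<open>X\<close> lead back to
  \<open>m\<close>, which is added to \<open>T\<close>.\<close>

lemma finite_msubst_closure:
  assumes "\<And>X. X \<in> free_vars e \<Longrightarrow> closed_expr (\<theta> X)" "\<And>X. closed_expr (\<theta> X) \<or> \<theta> X = Var X"
  shows "\<exists>T. finite T \<and> msubst \<theta> e \<in> T \<union> \<theta> ` free_vars e \<and>
    (\<forall>f\<in>T. \<forall>g. fl_step f g \<longrightarrow> g \<in> T \<union> \<theta> ` free_vars e)"
  using assms
proof (induction e arbitrary: \<theta>)
  case (Var X)
  show ?case by (rule exI[of _ "{}"]) auto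
next
  case (Lang A)
  show ?case by (rule exI[of _ "{Lang A}"]) (auto elim: fl_stepE)
next
  case (Act a e)
  then obtain T where "finite T" "msubst \<theta> e \<in> T \<union> \<theta> ` free_vars e"
    "\<forall>f\<in>T. \<forall>g. fl_step f g \<longrightarrow> g \<in> T \<union> \<theta> ` free_vars e"
    by (metis free_vars.simps(3))
  then show ?case
    by (intro exI[of _ "insert (msubst \<theta> (Act a e)) T"]) (auto elim: fl_stepE)
next
  case (Sum e1 e2)
  obtain T1 where T1: "finite T1" "msubst \<theta> e1 \<in> T1 \<union> \<theta> ` free_vars e1"
    "\<forall>f\<in>T1. \<forall>g. fl_step f g \<longrightarrow> g \<in> T1 \<union> \<theta> ` free_vars e1"
    using Sum.IH(1)[of \<theta>] Sum.prems by auto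
  obtain T2 where T2: "finite T2" "msubst \<theta> e2 \<in> T2 \<union> \<theta> ` free_vars e2"
    "\<forall>f\<in>T2. \<forall>g. fl_step f g \<longrightarrow> g \<in> T2 \<union> \<theta> ` free_vars e2"
    using Sum.IH(2)[of \<theta>] Sum.prems by auto
  show ?case
    using T1 T2
    by (intro exI[of _ "insert (msubst \<theta> (Sum e1 e2)) (T1 \<union> T2)"]) (auto elim!: fl_stepE; blast)
next
  case (Cap e1 e2)
  obtain T1 where T1: "finite T1" "msubst \<theta> e1 \<in> T1 \<union> \<theta> ` free_vars e1"
    "\<forall>f\<in>T1. \<forall>g. fl_step f g \<longrightarrow> g \<in> T1 \<union> \<theta> ` free_vars e1"
    using Cap.IH(1)[of \<theta>] Cap.prems by auto
  obtain T2 where T2: "finite T2" "msubst \<theta> e2 \<in> T2 \<union> \<theta> ` free_vars e2"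
    "\<forall>f\<in>T2. \<forall>g. fl_step f g \<longrightarrow> g \<in> T2 \<union> \<theta> ` free_vars e2"
    using Cap.IH(2)[of \<theta>] Cap.prems by auto
  show ?case
    using T1 T2
    by (intro exI[of _ "insert (msubst \<theta> (Cap e1 e2)) (T1 \<union> T2)"]) (auto elim!: fl_stepE; blast)
next
  case (Mu X e)
  define m where "m = msubst \<theta> (Mu X e)"
  have "closed_expr m"
    using free_vars_msubst[of "Mu X e" "{}" \<theta>] Mu.prems by (auto simp: m_def closed_expr_def)
  then have "\<exists>T. finite T \<and> msubst (\<theta>(X := m)) e \<in> T \<union> \<theta>(X := m) ` free_vars e \<and>
    (\<forall>f\<in>T. \<forall>g. fl_step f g \<longrightarrow> g \<in> T \<union> \<theta>(X := m) ` free_vars e)"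
    by (intro Mu.IH) (use Mu.prems in auto)
  then obtain T where T: "finite T"
    "msubst (\<theta>(X := m)) e \<in> T \<union> \<theta>(X := m) ` free_vars e"
    "\<forall>f\<in>T. \<forall>g. fl_step f g \<longrightarrow> g \<in> T \<union> \<theta>(X := m) ` free_vars e"
    by blast
  have "fl_step m g \<Longrightarrow> g = msubst (\<theta>(X := m)) e" for g
    using subst_msubst[of \<theta> X m e] Mu.prems
    by (auto simp: m_def elim: fl_stepE)
  moreover define U where "U = \<theta> ` free_vars (Mu X e)"
  have sub: "\<theta>(X := m) ` free_vars e \<subseteq> insert m U"
    by (auto simp: U_def)
  moreover have "msubst (\<theta>(X := m)) e \<in> insert m T \<union> U"
    using T(2) sub by blast
  moreover have "\<forall>f\<in>T. \<forall>g. fl_step f g \<longrightarrow> g \<in> insert m T \<union> U"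
    using T(3) sub by blast
  ultimately show ?case
    using T(1) unfolding m_def[symmetric] U_def[symmetric] by (intro exI[of _ "insert m T"]) auto
next
  case (Nu X e)
  define m where "m = msubst \<theta> (Nu X e)"
  have "closed_expr m"
    using free_vars_msubst[of "Nu X e" "{}" \<theta>] Nu.prems by (auto simp: m_def closed_expr_def)
  then have "\<exists>T. finite T \<and> msubst (\<theta>(X := m)) e \<in> T \<union> \<theta>(X := m) ` free_vars e \<and>
    (\<forall>f\<in>T. \<forall>g. fl_step f g \<longrightarrow> g \<in> T \<union> \<theta>(X := m) ` free_vars e)"
    by (intro Nu.IH) (use Nu.prems in auto)
  then obtain T where T: "finite T"
    "msubst (\<theta>(X := m)) e \<in> T \<union> \<theta>(X := m) ` free_vars e"
    "\<forall>f\<in>T. \<forall>g. fl_step f g \<longrightarrow> g \<in> T \<union> \<theta>(X := m) ` free_vars e"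
    by blast
  have "fl_step m g \<Longrightarrow> g = msubst (\<theta>(X := m)) e" for g
    using subst_msubst[of \<theta> X m e] Nu.prems
    by (auto simp: m_def elim: fl_stepE)
  moreover define U where "U = \<theta> ` free_vars (Nu X e)"
  have sub: "\<theta>(X := m) ` free_vars e \<subseteq> insert m U"
    by (auto simp: U_def)
  moreover have "msubst (\<theta>(X := m)) e \<in> insert m T \<union> U"
    using T(2) sub by blast
  moreover have "\<forall>f\<in>T. \<forall>g. fl_step f g \<longrightarrow> g \<in> insert m T \<union> U"
    using T(3) sub by blast
  ultimately show ?case
    using T(1) unfolding m_def[symmetric] U_def[symmetric] by (intro exI[of _ "insert m T"]) auto
qed

lemma finite_FL:
  assumes "closed_expr e"
  shows "finite (FL e)"
proof -
  obtain T where T: "finite T" "e \<in> T" "\<forall>f\<in>T. \<forall>g. fl_step f g \<longrightarrow> g \<in> T"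
    using finite_msubst_closure[of e Var] assms by (auto simp: closed_expr_def)
  have "f \<in> T" if "fl_step\<^sup>*\<^sup>* e f" for f
    using that T by induction auto
  then show ?thesis using T(1) by (auto simp: FL_def intro: finite_subset)
qed

section \<open>Formulas along an infinite trace\<close>

lemma fl_step_subformula_backward:
  assumes "fl_step f g" "m \<in> subformulas g" "height m \<le> height f"
  shows "m \<in> subformulas f"
  using assms
proof cases
  \<comment> \<open>Only unfoldings create new subformulas, and these contain \<open>f\<close>; the
    height bound then forces \<open>m = f\<close>.\<close>
  case (6 X h)
  then show ?thesis
    using assms subformula_substD[of m X f h] height_subformula[of f m]
    by (auto dest: subformulas_trans)
next
  case (7 X h)
  then show ?thesis
    using assms subformula_substD[of m X f h] height_subformula[of f m]
    by (auto dest: subformulas_trans)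
qed auto

text \<open>\<open>m\<close> is a recurring formula of least height. As the closure is finite,
  eventually only recurring formulas are visited, none lower than \<open>m\<close>; being a
  subformula then propagates backwards from each visit to \<open>m\<close>.\<close>

lemma trace_least_formula:
  fixes t :: "nat \<Rightarrow> 'a expr"
  assumes "closed_expr e" "\<And>i. t i \<in> FL e" "\<And>i. fl_step (t i) (t (Suc i))"
  obtains m N where "\<exists>\<^sub>\<infinity>i. t i = m" "\<And>i. i \<ge> N \<Longrightarrow> m \<in> subformulas (t i)"
    "(\<exists>X f. m = Mu X f) \<or> (\<exists>X f. m = Nu X f)"
proof -
  define I where "I = {f. \<exists>\<^sub>\<infinity>i. t i = f}"
  have fin: "finite (FL e)" by (rule finite_FL) fact
  have range: "range t \<subseteq> FL e" using assms(2) by blast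
  have "\<forall>f \<in> FL e - I. \<exists>N. \<forall>i\<ge>N. t i \<noteq> f"
    by (auto simp: I_def INFM_nat_le)
  then obtain b where b: "\<And>f i. f \<in> FL e - I \<Longrightarrow> i \<ge> b f \<Longrightarrow> t i \<noteq> f"
    by metis
  define N where "N = Max (insert 0 (b ` (FL e - I)))"
  have inI: "t i \<in> I" if "i \<ge> N" for i
  proof (rule ccontr)
    assume "t i \<notin> I"
    then have *: "t i \<in> FL e - I" using assms(2) by blast
    then have "b (t i) \<le> N" unfolding N_def using fin by (intro Max_ge) auto
    then show False using b[OF *, of i] that by simp
  qed
  then have "I \<noteq> {}" by blast
  then obtain m where m: "m \<in> I" "\<And>f. f \<in> I \<Longrightarrow> height m \<le> height f"
    using ex_has_least_nat[of "\<lambda>f. f \<in> I" _ height] by blast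
  have inf: "\<exists>\<^sub>\<infinity>i. t i = m" using m(1) by (simp add: I_def)
  have sub: "m \<in> subformulas (t i)" if "i \<ge> N" for i
  proof -
    obtain n where "n \<ge> i" "t n = m" using inf by (auto simp: INFM_nat_le)
    then show ?thesis
      using that
    proof (induction "n - i" arbitrary: i)
      case 0
      then show ?case by simp
    next
      case (Suc k)
      then have "m \<in> subformulas (t (Suc i))" by simp
      then show ?case
        using fl_step_subformula_backward assms(3) m(2) inI Suc.prems by blast
    qed
  qed
  obtain n where n: "n \<ge> N" "t n = m" using inf by (auto simp: INFM_nat_le)
  \<comment> \<open>Every step other than an unfolding strictly decreases the height, which this
    step from \<open>m\<close> cannot do.\<close>
  have "fl_step m (t (Suc n))" "height m \<le> height (t (Suc n))"
    using assms(3)[of n] m(2) inI n by simp_all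
  then have "(\<exists>X f. m = Mu X f) \<or> (\<exists>X f. m = Nu X f)"
    by cases auto
  then show thesis using that inf sub by blast
qed

section \<open>Annotated semantics\<close>

text \<open>
  Only closed fixed points are annotated: the operator of an open one depends on the environment,
  and \<open>below F w\<close> is not monotone in \<open>F\<close>.
\<close>

primrec sem :: "bool \<Rightarrow> ('a expr \<Rightarrow> 'a stream option) \<Rightarrow> (var \<Rightarrow> 'a stream set) \<Rightarrow>
    'a expr \<Rightarrow> 'a stream set" where
  "sem b \<alpha> \<rho> (Var X) = \<rho> X"
| "sem b \<alpha> \<rho> (Lang A) = A"
| "sem b \<alpha> \<rho> (Act a f) = {a ## w | w. w \<in> sem b \<alpha> \<rho> f}"
| "sem b \<alpha> \<rho> (Sum f g) = sem b \<alpha> \<rho> f \<union> sem b \<alpha> \<rho> g"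
| "sem b \<alpha> \<rho> (Cap f g) = sem b \<alpha> \<rho> f \<inter> sem b \<alpha> \<rho> g"
| "sem b \<alpha> \<rho> (Mu X f) =
    (case if b \<and> closed_expr (Mu X f) then \<alpha> (Mu X f) else None of
      None \<Rightarrow> lfp (\<lambda>A. sem b \<alpha> (\<rho>(X := A)) f)
    | Some w \<Rightarrow> below (\<lambda>A. sem b \<alpha> (\<rho>(X := A)) f) w)"
| "sem b \<alpha> \<rho> (Nu X f) =
    (case if \<not> b \<and> closed_expr (Nu X f) then \<alpha> (Nu X f) else None of
      None \<Rightarrow> gfp (\<lambda>A. sem b \<alpha> (\<rho>(X := A)) f)
    | Some w \<Rightarrow> - below (dual (\<lambda>A. sem b \<alpha> (\<rho>(X := A)) f)) w)"

lemma sem_cong: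
  assumes "\<And>g. g \<in> subformulas f \<Longrightarrow> \<alpha> g = \<alpha>' g" "\<And>X. X \<in> free_vars f \<Longrightarrow> \<rho> X = \<rho>' X"
  shows "sem b \<alpha> \<rho> f = sem b \<alpha>' \<rho>' f"
  using assms
proof (induction f arbitrary: \<rho> \<rho>')
  case (Act a f)
  then have "sem b \<alpha> \<rho> f = sem b \<alpha>' \<rho>' f" by simp
  then show ?case by simp
next
  case (Sum f g)
  then have "sem b \<alpha> \<rho> f = sem b \<alpha>' \<rho>' f" "sem b \<alpha> \<rho> g = sem b \<alpha>' \<rho>' g" by simp_all
  then show ?case by simp
next
  case (Cap f g)
  then have "sem b \<alpha> \<rho> f = sem b \<alpha>' \<rho>' f" "sem b \<alpha> \<rho> g = sem b \<alpha>' \<rho>' g" by simp_all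
  then show ?case by simp
next
  case (Mu X f)
  have eq: "(\<lambda>A. sem b \<alpha> (\<rho>(X := A)) f) = (\<lambda>A. sem b \<alpha>' (\<rho>'(X := A)) f)"
    by (intro ext Mu.IH) (use Mu.prems in auto)
  show ?case unfolding sem.simps eq using Mu.prems(1)[of "Mu X f"] by simp
next
  case (Nu X f)
  have eq: "(\<lambda>A. sem b \<alpha> (\<rho>(X := A)) f) = (\<lambda>A. sem b \<alpha>' (\<rho>'(X := A)) f)"
    by (intro ext Nu.IH) (use Nu.prems in auto)
  show ?case unfolding sem.simps eq using Nu.prems(1)[of "Nu X f"] by simp
qed auto

lemma sem_closed: "closed_expr f \<Longrightarrow> sem b \<alpha> \<rho> f = sem b \<alpha> \<rho>' f"
  by (rule sem_cong) (auto simp: closed_expr_def)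

text \<open>For a closed fixed point the environment is irrelevant, whatever its annotation; open
  ones ignore annotations, so monotonicity of \<open>lfp\<close> and \<open>gfp\<close> in the
  operator suffices.\<close>

lemma sem_mono: "(\<And>X. \<rho> X \<subseteq> \<rho>' X) \<Longrightarrow> sem b \<alpha> \<rho> f \<subseteq> sem b \<alpha> \<rho>' f"
proof (induction f arbitrary: \<rho> \<rho>')
  case (Sum f g)
  show ?case using Sum.IH[of \<rho> \<rho>'] Sum.prems by auto
next
  case (Cap f g)
  show ?case using Cap.IH[of \<rho> \<rho>'] Cap.prems by auto
next
  case (Act a f)
  show ?case using Act.IH[of \<rho> \<rho>'] Act.prems by auto
next
  case (Mu X f)
  show ?case
  proof (cases "closed_expr (Mu X f)")
    case True
    then show ?thesis using sem_closed[of "Mu X f" b \<alpha> \<rho> \<rho>'] by simp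
  next
    case False
    have "sem b \<alpha> (\<rho>(X := A)) f \<subseteq> sem b \<alpha> (\<rho>'(X := A)) f" for A
      by (rule Mu.IH) (simp add: Mu.prems)
    then show ?thesis using False by (simp add: lfp_mono)
  qed
next
  case (Nu X f)
  show ?case
  proof (cases "closed_expr (Nu X f)")
    case True
    then show ?thesis using sem_closed[of "Nu X f" b \<alpha> \<rho> \<rho>'] by simp
  next
    case False
    have "sem b \<alpha> (\<rho>(X := A)) f \<subseteq> sem b \<alpha> (\<rho>'(X := A)) f" for A
      by (rule Nu.IH) (simp add: Nu.prems)
    then show ?thesis using False by (simp add: gfp_mono)
  qed
qed auto

lemma mono_sem_upd: "mono (\<lambda>A. sem b \<alpha> (\<rho>(X := A)) f)"
  by (intro monoI sem_mono) auto

lemma sem_subst_Lang: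
  "sem b (\<lambda>_. None) \<rho> (subst X (Lang A) f) = sem b (\<lambda>_. None) (\<rho>(X := A)) f"
proof (induction f arbitrary: \<rho>)
  case (Mu Y f)
  then show ?case by (cases "Y = X") (simp_all add: fun_upd_twist[of X Y] del: fun_upd_apply)
next
  case (Nu Y f)
  then show ?case by (cases "Y = X") (simp_all add: fun_upd_twist[of X Y] del: fun_upd_apply)
qed auto

text \<open>Induction along the recursion of \<open>lang\<close>, whose fixed-point clauses
  substitute constants instead of updating an environment.\<close>

lemma lang_eq_sem: "closed_expr e \<Longrightarrow> lang e = sem b (\<lambda>_. None) \<rho> e"
proof (induction e arbitrary: \<rho> rule: lang.induct)
  case (6 X e)
  have "lang (subst X (Lang A) e) = sem b (\<lambda>_. None) (\<rho>(X := A)) e" for A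
    using 6 by (simp add: sem_subst_Lang closed_expr_def free_vars_subst_closed)
  then show ?case by (simp add: lfp_def)
next
  case (7 X e)
  have "lang (subst X (Lang A) e) = sem b (\<lambda>_. None) (\<rho>(X := A)) e" for A
    using 7 by (simp add: sem_subst_Lang closed_expr_def free_vars_subst_closed)
  then show ?case by (simp add: gfp_def)
qed (auto simp: closed_expr_def)

text \<open>The danger is a fixed point in \<open>f\<close> with \<open>X\<close> free: it is open
  and so unannotated, but its instance may be closed and pick up an annotation. The instance
  properly contains \<open>m\<close>, so the assumption on \<alpha> rules this out.\<close>

lemma sem_subst:
  assumes "closed_expr m" "\<And>g. m \<in> subformulas g \<Longrightarrow> g \<noteq> m \<Longrightarrow> \<alpha> g = None"
  shows "height f < height m \<Longrightarrow>
    sem b \<alpha> \<rho> (subst X m f) = sem b \<alpha> (\<rho>(X := sem b \<alpha> \<rho> m)) f"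
proof (induction f arbitrary: \<rho>)
  case (Mu Y f)
  show ?case
  proof (cases "X \<in> free_vars (Mu Y f)")
    case True
    then have *: "m \<in> subformulas (subst X m f)" "X \<noteq> Y"
      by (auto simp: subformula_subst_free)
    then have "height m < height (Mu Y (subst X m f))"
      using height_subformula by fastforce
    then have "Mu Y (subst X m f) \<noteq> m" by force
    then have "\<alpha> (Mu Y (subst X m f)) = None"
      using * by (intro assms(2)) simp_all
    moreover have "sem b \<alpha> (\<rho>(Y := A)) (subst X m f)
        = sem b \<alpha> (\<rho>(X := sem b \<alpha> \<rho> m, Y := A)) f" for A
      using Mu * sem_closed[OF assms(1), of b \<alpha> "\<rho>(Y := A)" \<rho>]
      by (simp add: fun_upd_twist del: fun_upd_apply)
    ultimately have "sem b \<alpha> \<rho> (Mu Y (subst X m f))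
        = lfp (\<lambda>A. sem b \<alpha> (\<rho>(X := sem b \<alpha> \<rho> m, Y := A)) f)"
      by (cases b) (simp_all del: fun_upd_apply)
    moreover have "\<not> closed_expr (Mu Y f)" using True by (auto simp: closed_expr_def)
    ultimately show ?thesis using * by (simp del: fun_upd_apply)
  next
    case False
    show ?thesis unfolding subst_fresh[OF False] by (rule sem_cong) (use False in auto)
  qed
next
  case (Nu Y f)
  show ?case
  proof (cases "X \<in> free_vars (Nu Y f)")
    case True
    then have *: "m \<in> subformulas (subst X m f)" "X \<noteq> Y"
      by (auto simp: subformula_subst_free)
    then have "height m < height (Nu Y (subst X m f))"
      using height_subformula by fastforce
    then have "Nu Y (subst X m f) \<noteq> m" by force
    then have "\<alpha> (Nu Y (subst X m f)) = None"
      using * by (intro assms(2)) simp_all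
    moreover have "sem b \<alpha> (\<rho>(Y := A)) (subst X m f)
        = sem b \<alpha> (\<rho>(X := sem b \<alpha> \<rho> m, Y := A)) f" for A
      using Nu * sem_closed[OF assms(1), of b \<alpha> "\<rho>(Y := A)" \<rho>]
      by (simp add: fun_upd_twist del: fun_upd_apply)
    ultimately have "sem b \<alpha> \<rho> (Nu Y (subst X m f))
        = gfp (\<lambda>A. sem b \<alpha> (\<rho>(X := sem b \<alpha> \<rho> m, Y := A)) f)"
      by (cases b) (simp_all del: fun_upd_apply)
    moreover have "\<not> closed_expr (Nu Y f)" using True by (auto simp: closed_expr_def)
    ultimately show ?thesis using * by (simp del: fun_upd_apply)
  next
    case False
    show ?thesis unfolding subst_fresh[OF False] by (rule sem_cong) (use False in auto)
  qed
qed auto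

text \<open>
  Dropping the annotations of the proper superformulas of the visited formula \<open>m\<close> matters twice:
  their operators mention the value of \<open>m\<close>, which is about to change, and unfolding \<open>m\<close> turns
  open subformulas of its body into closed formulas that contain \<open>m\<close>.
\<close>

definition annotate :: "('a, 'a expr) position \<Rightarrow> ('a expr \<Rightarrow> 'a stream option) \<Rightarrow>
    'a expr \<Rightarrow> 'a stream option" where
  "annotate p \<alpha> = (\<lambda>g. if g = snd p then Some (fst p)
    else if snd p \<in> subformulas g then None else \<alpha> g)"

definition holds :: "bool \<Rightarrow> ('a expr \<Rightarrow> 'a stream option) \<Rightarrow> ('a, 'a expr) position \<Rightarrow> bool" where
  "holds b \<alpha> p \<longleftrightarrow> (fst p \<in> sem b \<alpha> (\<lambda>_. {}) (snd p)) = b"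

text \<open>The update affects only formulas that contain the visited one, and these are too high to
  be subformulas of \<open>f\<close>.\<close>

lemma sem_annotate:
  assumes "height f < height (snd p)"
  shows "sem b (annotate p \<alpha>) \<rho> f = sem b \<alpha> \<rho> f"
proof (rule sem_cong)
  fix g assume "g \<in> subformulas f"
  then have "snd p \<notin> subformulas g"
    using assms height_subformula[of g f] height_subformula[of "snd p" g] by auto
  then show "annotate p \<alpha> g = \<alpha> g" by (auto simp: annotate_def)
qed simp

text \<open>For \<open>b\<close> true, the new annotation makes \<open>Mu X f\<close> denote
  \<open>below F w\<close>, and \<open>lfp_below\<close> puts \<open>w\<close> into
  \<open>F (below F w)\<close>, the value of the unfolding. For \<open>b\<close> false this is the
  ordinary unfolding of \<open>lfp F\<close>.\<close>

lemma sem_unfold_Mu: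
  assumes "closed_expr (Mu X f)" "(w \<in> sem b \<alpha> \<rho> (Mu X f)) = b"
  shows "(w \<in> sem b (annotate (w, Mu X f) \<alpha>) \<rho> (subst X (Mu X f) f)) = b"
proof -
  define \<alpha>' where "\<alpha>' = annotate (w, Mu X f) \<alpha>"
  define F where "F = (\<lambda>A. sem b \<alpha> (\<rho>(X := A)) f)"
  have F: "(\<lambda>A. sem b \<alpha>' (\<rho>(X := A)) f) = F"
    unfolding F_def \<alpha>'_def by (intro ext sem_annotate) simp
  note sem = assms(2)[unfolded sem.simps, folded F_def]
  have mono: "mono F" unfolding F_def by (rule mono_sem_upd)
  have "\<alpha>' (Mu X f) = Some w" by (simp add: \<alpha>'_def annotate_def)
  have "sem b \<alpha>' \<rho> (subst X (Mu X f) f) = sem b \<alpha>' (\<rho>(X := sem b \<alpha>' \<rho> (Mu X f))) f"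
    by (rule sem_subst[OF assms(1)]) (auto simp: \<alpha>'_def annotate_def)
  also have "\<dots> = F (sem b \<alpha>' \<rho> (Mu X f))"
    using F by (rule fun_cong)
  also have "sem b \<alpha>' \<rho> (Mu X f) = (if b then below F w else lfp F)"
    using assms(1) \<open>\<alpha>' (Mu X f) = Some w\<close> unfolding sem.simps F by simp
  finally have *: "sem b \<alpha>' \<rho> (subst X (Mu X f) f) = F (if b then below F w else lfp F)" .
  show ?thesis
  proof (cases b)
    case True
    \<comment> \<open>A previous annotation of \<open>Mu X f\<close> only shrinks its value to a
      subset of \<open>lfp F\<close>, so it may be overwritten.\<close>
    then have "w \<in> lfp F"
      using sem below_le_lfp[OF mono] by (auto split: option.splits if_splits)
    then show ?thesis using True * lfp_below[OF mono] by (simp add: \<alpha>'_def)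
  next
    case False
    then show ?thesis
      using sem * lfp_unfold[OF mono, symmetric] by (simp add: \<alpha>'_def)
  qed
qed

text \<open>The mirror image: for \<open>b\<close> false, a word outside the fixed point has a rank
  in \<open>lfp (dual F)\<close>.\<close>

lemma sem_unfold_Nu:
  assumes "closed_expr (Nu X f)" "(w \<in> sem b \<alpha> \<rho> (Nu X f)) = b"
  shows "(w \<in> sem b (annotate (w, Nu X f) \<alpha>) \<rho> (subst X (Nu X f) f)) = b"
proof -
  define \<alpha>' where "\<alpha>' = annotate (w, Nu X f) \<alpha>"
  define F where "F = (\<lambda>A. sem b \<alpha> (\<rho>(X := A)) f)"
  have F: "(\<lambda>A. sem b \<alpha>' (\<rho>(X := A)) f) = F"
    unfolding F_def \<alpha>'_def by (intro ext sem_annotate) simp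
  note sem = assms(2)[unfolded sem.simps, folded F_def]
  have mono: "mono F" unfolding F_def by (rule mono_sem_upd)
  have "\<alpha>' (Nu X f) = Some w" by (simp add: \<alpha>'_def annotate_def)
  have "sem b \<alpha>' \<rho> (subst X (Nu X f) f) = sem b \<alpha>' (\<rho>(X := sem b \<alpha>' \<rho> (Nu X f))) f"
    by (rule sem_subst[OF assms(1)]) (auto simp: \<alpha>'_def annotate_def)
  also have "\<dots> = F (sem b \<alpha>' \<rho> (Nu X f))"
    using F by (rule fun_cong)
  also have "sem b \<alpha>' \<rho> (Nu X f) = (if b then gfp F else - below (dual F) w)"
    using assms(1) \<open>\<alpha>' (Nu X f) = Some w\<close> unfolding sem.simps F by simp
  finally have *: "sem b \<alpha>' \<rho> (subst X (Nu X f) f) = F (if b then gfp F else - below (dual F) w)" .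
  show ?thesis
  proof (cases b)
    case False
    then have "w \<in> lfp (dual F)"
      using sem below_le_lfp[OF mono_dual[OF mono]]
      by (auto simp: gfp_eq_dual_lfp split: option.splits if_splits)
    then have "w \<in> dual F (below (dual F) w)" by (rule lfp_below[OF mono_dual[OF mono]])
    then show ?thesis using False * by (simp add: \<alpha>'_def dual_def)
  next
    case True
    then show ?thesis
      using sem * gfp_unfold[OF mono, symmetric] by (simp add: \<alpha>'_def)
  qed
qed

section \<open>The acceptance game\<close>

lemma move_expr_apa_iff:
  "move (expr_apa e c) (w, f) (w', f') \<longleftrightarrow>
    f \<in> FL e \<and> fl_step f f' \<and> (case f of Act a g \<Rightarrow> w = a ## w' | _ \<Rightarrow> w' = w)"
proof
  assume "move (expr_apa e c) (w, f) (w', f')"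
  then show "f \<in> FL e \<and> fl_step f f' \<and> (case f of Act a g \<Rightarrow> w = a ## w' | _ \<Rightarrow> w' = w)"
    by cases (auto simp: expr_apa_def expr_trans.simps fl_step.intros(1) split: expr.split)
next
  assume *: "f \<in> FL e \<and> fl_step f f' \<and> (case f of Act a g \<Rightarrow> w = a ## w' | _ \<Rightarrow> w' = w)"
  then have "f' \<in> FL e" using FL_step by blast
  show "move (expr_apa e c) (w, f) (w', f')"
  proof (cases "\<exists>a g. f = Act a g")
    case True
    then show ?thesis using * \<open>f' \<in> FL e\<close>
      by (auto simp: expr_apa_def elim!: fl_stepE(3) intro!: move.intros(1) expr_trans.intros(1))
  next
    case False
    then have "w' = w" using * by (auto split: expr.splits)
    then show ?thesis using * False \<open>f' \<in> FL e\<close>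
      by (auto simp: expr_apa_def intro!: move.intros(2) expr_trans.intros(2))
  qed
qed

text \<open>Where player \<open>b\<close> has no genuine choice, the claim passes to every
  successor: by unfolding at fixed points, and elsewhere because the successor is lower than
  \<open>f\<close> and untouched by the new annotation.\<close>

lemma holds_move:
  assumes "closed_expr f" "holds b \<alpha> (w, f)" "move (expr_apa e c) (w, f) (w', f')"
    "\<nexists>g h. f = (if b then Sum g h else Cap g h)"
  shows "holds b (annotate (w, f) \<alpha>) (w', f')"
proof -
  have "fl_step f f'" "case f of Act a g \<Rightarrow> w = a ## w' | _ \<Rightarrow> w' = w"
    using assms(3) by (simp_all add: move_expr_apa_iff)
  then show ?thesis
    using assms(1,2,4)
    by cases (auto simp: holds_def sem_annotate sem_unfold_Mu sem_unfold_Nu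
        simp del: sem.simps(6,7) split: if_splits)
qed

text \<open>Only a letter mismatch at an \<open>Act\<close> can block a play. A true membership
  claim excludes it; a true non-membership claim does not, hence the extra assumption for
  \<open>b\<close> false.\<close>

lemma holds_move_exists:
  assumes "closed_expr f" "rll f" "f \<in> FL e" "holds b \<alpha> (w, f)"
    "b \<or> \<not> stuck (expr_apa e c) (w, f)"
  shows "\<exists>p. move (expr_apa e c) (w, f) p \<and> holds b (annotate (w, f) \<alpha>) p"
proof (cases "\<exists>g h. f = (if b then Sum g h else Cap g h)")
  case True
  then obtain g h where f: "f = (if b then Sum g h else Cap g h)" by blast
  then obtain k where "k \<in> {g, h}" "holds b \<alpha> (w, k)"
    using assms(4) by (cases b) (auto simp: holds_def)
  then have "move (expr_apa e c) (w, f) (w, k)" "holds b (annotate (w, f) \<alpha>) (w, k)"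
    using assms(3) f
    by (auto simp: move_expr_apa_iff holds_def sem_annotate intro: fl_step.intros split: if_splits)
  then show ?thesis by blast
next
  case False
  have "\<not> stuck (expr_apa e c) (w, f)"
  proof (cases "\<exists>a g. f = Act a g \<and> b")
    case True
    then show ?thesis
      using assms(3,4) by (auto simp: stuck_def holds_def move_expr_apa_iff intro: fl_step.intros)
  next
    case False
    then show ?thesis
      using assms
      by (cases f) (auto simp: stuck_def closed_expr_def move_expr_apa_iff intro: fl_step.intros)
  qed
  then show ?thesis
    using holds_move[OF assms(1,4)] False by (fastforce simp: stuck_def)
qed

text \<open>Each late return to \<open>m\<close> puts the current word below that of the previous
  visit, for one fixed operator; this contradicts well-foundedness of the rank.\<close>

lemma annotated_formula_not_recurrent:
  fixes p :: "nat \<Rightarrow> ('a, 'a expr) position"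
  assumes "closed_expr m" "m = (if b then Mu X f else Nu X f)"
    "\<exists>\<^sub>\<infinity>i. snd (p i) = m" "\<And>i. i \<ge> N \<Longrightarrow> m \<in> subformulas (snd (p i))"
    "\<And>i. \<alpha> (Suc i) = annotate (p i) (\<alpha> i)" "\<And>i. holds b (\<alpha> i) (p i)"
  shows False
proof -
  define F where "F i A = sem b (\<alpha> i) ((\<lambda>_. {})(X := A)) f" for i A
  define D where "D = (if b then F N else dual (F N))"
  \<comment> \<open>Formulas visited from \<open>N\<close> on contain \<open>m\<close> and are
    higher than its body, so the operator of \<open>m\<close> no longer changes.\<close>
  have F_eq: "F i = F N" if "i \<ge> N" for i
    using that
  proof (induction rule: dec_induct)
    case (step i)
    have "height f < height m" by (simp add: assms(2))
    then have "height f < height (snd (p i))"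
      using height_subformula[OF assms(4)[OF step(1)]] by auto
    then show ?case using step by (simp add: F_def fun_eq_iff assms(5) sem_annotate)
  qed simp
  have F: "sem b (\<alpha> i) ((\<lambda>_. {})(X := A)) f = F N A" if "i \<ge> N" for i A
    using fun_cong[OF F_eq[OF that], of A] unfolding F_def .
  have "mono (F N)" unfolding F_def by (rule mono_sem_upd)
  then have "mono D" by (simp add: D_def mono_dual)
  \<comment> \<open>A late visit \<open>i\<close> whose word has minimal rank will be contradicted
    at the next visit \<open>j\<close>.\<close>
  define Q where "Q = {fst (p i) | i. i \<ge> N \<and> snd (p i) = m}"
  have "Q \<noteq> {}" using assms(3) unfolding Q_def INFM_nat_le by blast
  then obtain i where i: "i \<ge> N" "snd (p i) = m" "below D (fst (p i)) \<inter> Q = {}"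
    using below_minimal[OF \<open>mono D\<close>, of Q] unfolding Q_def by blast
  have "\<exists>j. j > i \<and> snd (p j) = m"
    using assms(3) by (auto simp: INFM_nat)
  define j where "j = (LEAST j. j > i \<and> snd (p j) = m)"
  have j: "j > i" "snd (p j) = m"
    using LeastI_ex[OF \<open>\<exists>j. j > i \<and> snd (p j) = m\<close>] by (simp_all add: j_def)
  have between: "snd (p k) \<noteq> m" if "i < k" "k < j" for k
    using not_less_Least[of k "\<lambda>j. j > i \<and> snd (p j) = m"] that by (auto simp: j_def)
  have "Suc i \<le> j" using j(1) by simp
  then have "\<alpha> j m = Some (fst (p i))"
  proof (induction rule: dec_induct)
    case base
    then show ?case using i(2) by (simp add: assms(5) annotate_def)
  next
    case (step k)
    then have "snd (p k) \<noteq> m" using between by simp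
    \<comment> \<open>Strictly between the two visits the formulas properly contain
      \<open>m\<close>, so \<open>annotate\<close> neither sets nor drops its annotation.\<close>
    moreover have "snd (p k) \<notin> subformulas m"
      using height_subformula[of "snd (p k)" m] height_subformula[OF assms(4)[of k]]
        calculation i(1) step(1) by auto
    ultimately show ?case using step by (simp add: assms(5) annotate_def)
  qed
  then have "fst (p j) \<in> below D (fst (p i))"
    using assms(6)[of j] assms(1) j i(1) F[of j]
    by (cases b) (simp_all add: holds_def assms(2) D_def)
  moreover have "fst (p j) \<in> Q"
    unfolding Q_def using i(1) j by (intro CollectI exI[of _ j]) simp
  ultimately show False using i(3) by blast
qed

section \<open>The winner of a play along which a claim stays true\<close>

lemma parity_win_iff:
  assumes "\<exists>\<^sub>\<infinity>n. c n = k" "\<And>n. n \<ge> N \<Longrightarrow> k \<le> c n"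
  shows "parity_win c \<longleftrightarrow> even k"
proof -
  have least: "k \<le> j" if "\<exists>\<^sub>\<infinity>n. c n = j" for j
    using that assms(2) unfolding INFM_nat_le by blast
  then show ?thesis unfolding parity_win_def using assms(1) by (metis order_antisym)
qed

text \<open>Computed from the history, so that a strategy can consult it.
  \<open>annotation \<rho>\<close> already records \<open>last \<rho>\<close> and goes with the next
  position; the claim at \<open>last \<rho>\<close> itself uses
  \<open>annotation (butlast \<rho>)\<close>.\<close>

definition annotation :: "('a, 'a expr) position list \<Rightarrow> 'a expr \<Rightarrow> 'a stream option" where
  "annotation \<rho> = fold annotate \<rho> (\<lambda>_. None)"

lemma annotation_snoc: "annotation (\<rho> @ [p]) = annotate p (annotation \<rho>)"
  by (simp add: annotation_def)

text \<open>The least recurring formula is not a bad fixed point for player \<open>b\<close>, so its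
  colour has the parity this player wants. Being a subformula of all later formulas, it has the
  least recurring colour.\<close>

lemma parity_win_play:
  assumes "closed_expr e" "is_colouring e c"
    "\<And>i. move (expr_apa e c) (\<pi> i) (\<pi> (Suc i))"
    "\<And>i. holds b (annotation (map \<pi> [0..<i])) (\<pi> i)"
  shows "parity_win (\<lambda>n. c (snd (\<pi> n))) \<longleftrightarrow> b"
proof -
  have "snd (\<pi> i) \<in> FL e \<and> fl_step (snd (\<pi> i)) (snd (\<pi> (Suc i)))" for i
    using assms(3)[of i] by (cases "\<pi> i"; cases "\<pi> (Suc i)") (simp add: move_expr_apa_iff)
  then have FL: "snd (\<pi> i) \<in> FL e" and step: "fl_step (snd (\<pi> i)) (snd (\<pi> (Suc i)))" for i
    by simp_all
  obtain m N where m: "\<exists>\<^sub>\<infinity>i. snd (\<pi> i) = m" "\<And>i. i \<ge> N \<Longrightarrow> m \<in> subformulas (snd (\<pi> i))"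
    "(\<exists>X f. m = Mu X f) \<or> (\<exists>X f. m = Nu X f)"
    using trace_least_formula[of e "\<lambda>i. snd (\<pi> i)"] assms(1) FL step by metis
  have "m \<in> FL e" using m(1) FL by (auto simp: INFM_nat)
  have "m \<noteq> (if b then Mu X f else Nu X f)" for X f
  proof
    assume "m = (if b then Mu X f else Nu X f)"
    then show False
    proof (rule annotated_formula_not_recurrent[OF FL_closed[OF assms(1) \<open>m \<in> FL e\<close>]])
      show "annotation (map \<pi> [0..<Suc i]) = annotate (\<pi> i) (annotation (map \<pi> [0..<i]))" for i
        by (simp add: annotation_snoc)
    qed (use m(1,2) assms(4) in auto)
  qed
  then have "even (c m) \<longleftrightarrow> b"
    using m(3) assms(2) \<open>m \<in> FL e\<close> by (cases b) (auto simp: is_colouring_def)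
  moreover have "parity_win (\<lambda>n. c (snd (\<pi> n))) \<longleftrightarrow> even (c m)"
  proof (rule parity_win_iff)
    show "\<exists>\<^sub>\<infinity>n. c (snd (\<pi> n)) = c m" using m(1) by (rule INFM_mono) simp
    show "c m \<le> c (snd (\<pi> n))" if "n \<ge> N" for n
      using assms(2) m(2)[OF that] FL \<open>m \<in> FL e\<close> by (auto simp: is_colouring_def)
  qed
  ultimately show ?thesis by simp
qed

section \<open>The two inclusions\<close>

lemma conforming_nonempty: "conforming A S p \<rho> \<Longrightarrow> \<rho> \<noteq> []"
  by (induction rule: conforming.induct) auto

lemma conforming_snocD:
  assumes "conforming A S p (\<rho> @ [p'])" "\<rho> \<noteq> []"
  shows "move A (last \<rho>) p'"
  using assms by (cases rule: conforming.cases) auto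

lemma lang_subset_accepted:
  assumes "rll e" "closed_expr e" "is_colouring e c"
  shows "lang e \<subseteq> accepted (expr_apa e c)"
proof
  fix w assume "w \<in> lang e"
  let ?A = "expr_apa e c"
  \<comment> \<open>Any move that keeps the annotated claim true will do; the annotations force the
    ranks to decrease.\<close>
  define S where "S \<rho> = (SOME p. move ?A (last \<rho>) p \<and> holds True (annotation \<rho>) p)" for \<rho>
  have ex: "\<exists>p. move ?A (last \<rho>) p \<and> holds True (annotation \<rho>) p"
    if "\<rho> \<noteq> []" "snd (last \<rho>) \<in> FL e" "holds True (annotation (butlast \<rho>)) (last \<rho>)" for \<rho>
    using holds_move_exists[of "snd (last \<rho>)" e True "annotation (butlast \<rho>)" "fst (last \<rho>)" c]
      that FL_closed[OF assms(2)] FL_rll[OF assms(1)]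
      annotation_snoc[of "butlast \<rho>" "last \<rho>"] by simp
  have S: "move ?A (last \<rho>) (S \<rho>) \<and> holds True (annotation \<rho>) (S \<rho>)"
    if "\<rho> \<noteq> []" "snd (last \<rho>) \<in> FL e" "holds True (annotation (butlast \<rho>)) (last \<rho>)" for \<rho>
    unfolding S_def by (rule someI_ex[OF ex[OF that]])
  have inv: "snd (last \<rho>) \<in> FL e \<and> holds True (annotation (butlast \<rho>)) (last \<rho>)"
    if "conforming ?A S (w, e) \<rho>" for \<rho>
    using that
  proof induction
    case 1
    have "w \<in> sem True (\<lambda>_. None) (\<lambda>_. {}) e"
      using \<open>w \<in> lang e\<close> lang_eq_sem[OF assms(2)] by metis
    then show ?case by (simp add: FL_refl holds_def annotation_def)
  next
    case (2 \<rho> p')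
    have "\<rho> \<noteq> []" using 2(1) by (rule conforming_nonempty)
    obtain v f v' f' where *: "last \<rho> = (v, f)" "p' = (v', f')" by fastforce
    have "f \<in> FL e" "f' \<in> FL e"
      using 2(2) FL_step unfolding * move_expr_apa_iff by blast+
    moreover have "holds True (annotation \<rho>) p'"
    proof (cases "\<exists>g h. f = Sum g h")
      case True
      then have "p' = S \<rho>"
        using 2(3) \<open>f \<in> FL e\<close> * by (auto simp: expr_apa_def)
      then show ?thesis using S \<open>\<rho> \<noteq> []\<close> 2(4) by blast
    next
      \<comment> \<open>This includes \<open>0\<close>, an existential state whose only move is
        forced.\<close>
      case False
      then have "holds True (annotate (last \<rho>) (annotation (butlast \<rho>))) p'"
        using 2(2,4) FL_closed[OF assms(2) \<open>f \<in> FL e\<close>] unfolding *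
        by (intro holds_move) auto
      then show ?thesis using \<open>\<rho> \<noteq> []\<close> by (simp flip: annotation_snoc)
    qed
    ultimately show ?case using * by simp
  qed
  have "winning_strategy ?A S (w, e)"
    unfolding winning_strategy_def
  proof (intro conjI allI impI; (elim conjE)?)
    fix \<rho> assume "conforming ?A S (w, e) \<rho>"
    then show "move ?A (last \<rho>) (S \<rho>)" using S inv conforming_nonempty by blast
  next
    fix \<rho> assume "conforming ?A S (w, e) \<rho>" "stuck ?A (last \<rho>)"
    then show "snd (last \<rho>) \<in> universal ?A"
      using ex inv conforming_nonempty unfolding stuck_def by blast
  next
    fix \<pi> assume conf: "\<forall>n. conforming ?A S (w, e) (map \<pi> [0..<Suc n])"
    have "move ?A (\<pi> i) (\<pi> (Suc i))" for i
      using conforming_snocD[of ?A S "(w, e)" "map \<pi> [0..<Suc i]" "\<pi> (Suc i)"]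
        spec[OF conf, of "Suc i"] by simp
    moreover have "holds True (annotation (map \<pi> [0..<i])) (\<pi> i)" for i
      using inv[OF spec[OF conf, of i]] by simp
    ultimately show "parity_win (\<lambda>n. colour ?A (snd (\<pi> n)))"
      using parity_win_play[OF assms(2,3), of \<pi> True] by (simp add: expr_apa_def)
  qed
  then show "w \<in> accepted ?A" by (auto simp: accepted_def expr_apa_def)
qed

text \<open>Determinacy is not invoked: against a winning strategy for a word outside
  \<open>lang e\<close>, the universal moves are chosen to keep non-membership true, which yields an
  infinite conforming play of the wrong parity.\<close>

lemma accepted_subset_lang:
  assumes "rll e" "closed_expr e" "is_colouring e c"
  shows "accepted (expr_apa e c) \<subseteq> lang e"
proof (rule ccontr)
  let ?A = "expr_apa e c"
  assume "\<not> accepted ?A \<subseteq> lang e"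
  then obtain w S where "w \<notin> lang e" and win: "winning_strategy ?A S (w, e)"
    by (auto simp: accepted_def expr_apa_def)
  define J where "J \<rho> \<longleftrightarrow> conforming ?A S (w, e) \<rho> \<and> snd (last \<rho>) \<in> FL e \<and>
    holds False (annotation (butlast \<rho>)) (last \<rho>)" for \<rho>
  have step: "\<exists>p. J (\<rho> @ [p])" if "J \<rho>" for \<rho>
  proof -
    have conf: "conforming ?A S (w, e) \<rho>" and FL: "snd (last \<rho>) \<in> FL e"
      and holds: "holds False (annotation (butlast \<rho>)) (last \<rho>)"
      using that by (auto simp: J_def)
    have "\<rho> \<noteq> []" using conf by (rule conforming_nonempty)
    then have ann: "annotation \<rho> = annotate (last \<rho>) (annotation (butlast \<rho>))"
      by (simp flip: annotation_snoc)
    obtain v f where *: "last \<rho> = (v, f)" by fastforce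
    have "closed_expr f" "rll f" "f \<in> FL e"
      using FL FL_closed[OF assms(2)] FL_rll[OF assms(1)] * by auto
    \<comment> \<open>A winning strategy lets plays get stuck only in universal states, but these
      always have an \<epsilon>-move.\<close>
    have "\<not> stuck ?A (last \<rho>)"
    proof
      assume st: "stuck ?A (last \<rho>)"
      then have "f \<in> universal ?A"
        using win conf * unfolding winning_strategy_def by fastforce
      then obtain f' where "fl_step f f'" "\<nexists>a g. f = Act a g"
        by (auto simp: expr_apa_def intro: fl_step.intros)
      then have "move ?A (v, f) (v, f')"
        using \<open>f \<in> FL e\<close> by (auto simp: move_expr_apa_iff split: expr.split)
      then show False using st * by (auto simp: stuck_def)
    qed
    have "\<exists>p. move ?A (last \<rho>) p \<and> (f \<in> existential ?A \<longrightarrow> p = S \<rho>) \<and> holds False (annotation \<rho>) p"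
    proof (cases "f \<in> existential ?A")
      \<comment> \<open>At a sum or \<open>0\<close> every move preserves non-membership, in
        particular the one dictated by \<open>S\<close>.\<close>
      case True
      then have mv: "move ?A (last \<rho>) (S \<rho>)"
        using win conf \<open>\<not> stuck ?A (last \<rho>)\<close> * unfolding winning_strategy_def by fastforce
      moreover have "holds False (annotation \<rho>) (S \<rho>)"
        unfolding ann *
        using holds_move[of f False "annotation (butlast \<rho>)" v e c "fst (S \<rho>)" "snd (S \<rho>)"]
          mv holds True \<open>closed_expr f\<close> * by (auto simp: expr_apa_def)
      ultimately show ?thesis by blast
    next
      case False
      then show ?thesis
        using holds_move_exists[OF \<open>closed_expr f\<close> \<open>rll f\<close> \<open>f \<in> FL e\<close>] holds
          \<open>\<not> stuck ?A (last \<rho>)\<close> unfolding ann * by blast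
    qed
    then obtain p where p: "move ?A (last \<rho>) p" "f \<in> existential ?A \<longrightarrow> p = S \<rho>"
      "holds False (annotation \<rho>) p" by blast
    have "snd p \<in> FL e"
      using p(1) FL_step[of f e "snd p"] unfolding * by (cases p) (simp add: move_expr_apa_iff)
    moreover have "conforming ?A S (w, e) (\<rho> @ [p])"
      by (rule conforming.intros(2)[OF conf p(1)]) (use p(2) * in simp)
    ultimately have "J (\<rho> @ [p])" using p(3) by (simp add: J_def)
    then show ?thesis ..
  qed
  define nxt where "nxt \<rho> = (SOME p. J (\<rho> @ [p]))" for \<rho>
  define hist where "hist = rec_nat [(w, e)] (\<lambda>_ \<rho>. \<rho> @ [nxt \<rho>])"
  define \<pi> where "\<pi> n = last (hist n)" for n
  have hist_Suc: "hist (Suc n) = hist n @ [nxt (hist n)]" for n by (simp add: hist_def)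
  have hist: "hist n = map \<pi> [0..<Suc n]" for n
  proof (induction n)
    case 0
    then show ?case by (simp add: \<pi>_def hist_def)
  next
    case (Suc n)
    have "\<pi> (Suc n) = nxt (hist n)" by (simp add: \<pi>_def hist_Suc)
    then show ?case using Suc by (simp add: hist_Suc)
  qed
  have J: "J (hist n)" for n
  proof (induction n)
    case 0
    have "w \<notin> sem False (\<lambda>_. None) (\<lambda>_. {}) e"
      using \<open>w \<notin> lang e\<close> lang_eq_sem[OF assms(2)] by metis
    then show ?case
      by (simp add: J_def hist_def FL_refl holds_def annotation_def conforming.intros)
  next
    case (Suc n)
    then show ?case unfolding hist_Suc nxt_def by (rule someI_ex[OF step])
  qed
  then have conf: "conforming ?A S (w, e) (map \<pi> [0..<Suc n])" for n
    by (simp add: J_def hist)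
  have "move ?A (\<pi> i) (\<pi> (Suc i))" for i
    using conforming_snocD[of ?A S "(w, e)" "map \<pi> [0..<Suc i]" "\<pi> (Suc i)"] conf[of "Suc i"]
    by simp
  moreover have "holds False (annotation (map \<pi> [0..<i])) (\<pi> i)" for i
    using J[of i] by (simp add: J_def hist)
  ultimately have "\<not> parity_win (\<lambda>n. colour ?A (snd (\<pi> n)))"
    using parity_win_play[OF assms(2,3), of \<pi> False] by (simp add: expr_apa_def)
  then show False using win conf unfolding winning_strategy_def by blast
qed

theorem theorem8:
  fixes e :: "'a::finite expr" and c :: "'a expr \<Rightarrow> nat"
  assumes "rll e" and "closed_expr e" and "is_colouring e c"
  shows "lang e = accepted (expr_apa e c)"
  using assms by (intro equalityI lang_subset_accepted accepted_subset_lang)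

end
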